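(* Let $n\ge 5$ be an odd integer and let $G=(V,E)$ be the cycle graph with $n$ vertices. Then every load distribution on $G$ can be reduced to a single-level tree distribution without decreasing the flow: for every load distribution $\vec m=(m_v)_{v\in V}$ on $G$ with total load $D=\sum_{v\in V}m_v$, there exists a single-level tree distribution $\vec m'=(m'_v)_{v\in V}$ on $G$ with the same total load $\sum_{v\in V}m'_v=D$ such that $\mathcal F(\vec m')\ge \mathcal F(\vec m)$.
   Context: A load distribution on a finite graph $G=(V,E)$ is a vector $\vec m=(m_v)_{v\in V}$ of real numbers $m_v\ge 0$; its total load is $D=\sum_{v\in V}m_v$. The flow of $\vec m$ is $$\mathcal F(\vec m)=\sum_{\{u,v\}\in E} m_u m_v,$$ where each (undirected) edge is counted once. A single-level tree is a star: a root node together with leaf nodes, each adjacent to the root. A load distribution $\vec m'$ on $G$ is a single-level tree distribution if its non-zero loads lie on a star in $G$, i.e. there is a vertex $r\in V$ such that $m'_v=0$ for every vertex $v\ne r$ that is not adjacent to $r$. *)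

theory Defs
  imports Complex_Main
begin

text \<open>
  A finite simple graph is given by its vertex set \<open>V\<close> and its set \<open>E\<close> of undirected edges,
  each edge being a two-element subset of \<open>V\<close>. The vertices may have any type.
\<close>

text \<open>
  The graph is a cycle on \<open>n\<close> vertices if the vertices can be listed without
  repetition as \<open>c 0, \<dots>, c (n - 1)\<close> so that the edges are exactly the pairs of
  cyclically consecutive vertices.
\<close>

definition cycle_graph :: "nat \<Rightarrow> 'a set \<Rightarrow> 'a set set \<Rightarrow> bool" where
  "cycle_graph n V E \<longleftrightarrow> 3 \<le> n \<and>
     (\<exists>c. bij_betw c {..<n} V \<and> E = {{c i, c ((i + 1) mod n)} | i. i < n})"

text \<open>Load vectors are total functions; only their values on \<open>V\<close> are ever used.\<close>

definition load_distribution :: "'a set \<Rightarrow> ('a \<Rightarrow> real) \<Rightarrow> bool" where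
  "load_distribution V m \<longleftrightarrow> (\<forall>v\<in>V. 0 \<le> m v)"

definition total_load :: "'a set \<Rightarrow> ('a \<Rightarrow> real) \<Rightarrow> real" where
  "total_load V m = (\<Sum>v\<in>V. m v)"

text \<open>
  Since an edge is a two-element set \<open>e = {u, v}\<close>, the product over \<open>e\<close> is
  \<open>m u * m v\<close> (lemma \<open>prod_edge\<close>), and every undirected edge contributes once.
\<close>

definition flow :: "'a set set \<Rightarrow> ('a \<Rightarrow> real) \<Rightarrow> real" where
  "flow E m = (\<Sum>e\<in>E. \<Prod>v\<in>e. m v)"

definition single_level_tree_distribution ::
    "'a set \<Rightarrow> 'a set set \<Rightarrow> ('a \<Rightarrow> real) \<Rightarrow> bool" where
  "single_level_tree_distribution V E m \<longleftrightarrow> load_distribution V m \<and>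
     (\<exists>r\<in>V. \<forall>v\<in>V. v \<noteq> r \<and> {r, v} \<notin> E \<longrightarrow> m v = 0)"

lemma prod_edge: "u \<noteq> v \<Longrightarrow> (\<Prod>w\<in>{u, v}. m w) = m u * (m v :: real)"
  by simp

lemma cycle_graph_finite_simple:
  assumes "cycle_graph n V E"
  shows "finite V" and "card V = n" and "\<And>e. e \<in> E \<Longrightarrow> e \<subseteq> V \<and> card e = 2"
proof -
  obtain c where n: "3 \<le> n" and c: "bij_betw c {..<n} V"
    and E: "E = {{c i, c ((i + 1) mod n)} | i. i < n}"
    using assms unfolding cycle_graph_def by blast
  show "finite V" using bij_betw_finite[OF c] by simp
  show "card V = n" using bij_betw_same_card[OF c] by simp
  fix e assume "e \<in> E"
  then obtain i where i: "i < n" and e: "e = {c i, c ((i + 1) mod n)}"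
    using E by blast
  have j: "(i + 1) mod n < n" using n by simp
  have "i \<noteq> (i + 1) mod n" using i n by (cases "i + 1 = n") auto
  then have "c i \<noteq> c ((i + 1) mod n)"
    using c i j unfolding bij_betw_def inj_on_def by blast
  moreover have "c i \<in> V" "c ((i + 1) mod n) \<in> V"
    using c i j by (auto dest: bij_betwE)
  ultimately show "e \<subseteq> V \<and> card e = 2" unfolding e by simp
qed

end

theory Submission
  imports Defs
begin

text \<open>
  The flow of any distribution is at most \<open>D\<^sup>2 / 4\<close>, and this value is attained by placing \<open>D / 2\<close>
  on each end of an edge. For the bound, cut the odd cycle open just after a vertex of minimal
  load and number the vertices \<open>0, \<dots>, 2k\<close>. The product of the total even load and the total odd
  load contains all the products along the path \<open>0, \<dots>, 2k\<close> and also \<open>f 0 * f 3\<close>, which dominates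
  the remaining edge \<open>f (2k) * f 0\<close> because \<open>f (2k)\<close> is minimal.
\<close>

lemma sum_shift_periodic:
  fixes p :: "nat \<Rightarrow> 'a::cancel_comm_monoid_add"
  assumes "\<And>i. p (i + n) = p i"
  shows "(\<Sum>i<n. p (i + k)) = (\<Sum>i<n. p i)"
proof (induction k)
  case 0
  show ?case by simp
next
  case (Suc k)
  \<comment> \<open>A window of \<open>n + 1\<close> consecutive values is peeled at either end; the
    end values \<open>p k\<close> and \<open>p (n + k)\<close> agree.\<close>
  have "p k + (\<Sum>i<n. p (i + Suc k)) = (\<Sum>i<Suc n. p (i + k))"
    by (simp only: sum.lessThan_Suc_shift) simp
  also have "\<dots> = p k + (\<Sum>i<n. p (i + k))"
    using assms[of k] by (simp add: add.commute)
  finally show ?case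
    using Suc.IH by simp
qed

text \<open>Each term on the left pairs an even with an odd index, so it occurs in the expanded
  product. The induction starts at \<open>k = 2\<close>, where index 3 first becomes available, and
  appends two vertices at a time.\<close>

lemma path_products_plus_chord_le:
  fixes f :: "nat \<Rightarrow> real"
  assumes "2 \<le> k" and nonneg: "\<And>i. 0 \<le> f i"
  shows "(\<Sum>i<2 * k. f i * f (i + 1)) + f 0 * f 3
         \<le> (\<Sum>i\<le>k. f (2 * i)) * (\<Sum>i<k. f (2 * i + 1))"
  using \<open>2 \<le> k\<close>
proof (induction k rule: dec_induct)
  case base
  \<comment> \<open>For \<open>k = 2\<close> this is the only term of the expanded product missing
    on the left.\<close>
  have "0 \<le> f 4 * f 1"
    by (simp add: nonneg)
  then show ?case
    by (simp add: numeral_eq_Suc algebra_simps)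
next
  case (step k)
  \<comment> \<open>The product grows by \<open>X * f (2 * k + 1)\<close>, which covers one new path
    edge because \<open>f (2 * k)\<close> is a summand of \<open>X\<close>, by the other new edge
    exactly, and by the nonnegative \<open>f (2 * k + 2) * Y\<close>.\<close>
  define X where "X = (\<Sum>i\<le>k. f (2 * i))"
  define Y where "Y = (\<Sum>i<k. f (2 * i + 1))"
  have X: "f (2 * k) \<le> X"
    unfolding X_def by (rule member_le_sum) (auto simp: nonneg)
  have "f (2 * k) * f (2 * k + 1) \<le> X * f (2 * k + 1)"
    by (intro mult_right_mono X nonneg)
  moreover have "0 \<le> f (2 * k + 2) * Y"
    unfolding Y_def by (intro mult_nonneg_nonneg sum_nonneg nonneg)
  moreover have "(\<Sum>i<2 * k. f i * f (i + 1)) + f 0 * f 3 \<le> X * Y"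
    using step.IH by (simp add: X_def Y_def)
  moreover have "(\<Sum>i\<le>Suc k. f (2 * i)) = X + f (2 * k + 2)"
    and "(\<Sum>i<Suc k. f (2 * i + 1)) = Y + f (2 * k + 1)"
    by (simp_all add: X_def Y_def)
  moreover have "(\<Sum>i<2 * Suc k. f i * f (i + 1))
      = (\<Sum>i<2 * k. f i * f (i + 1)) + f (2 * k) * f (2 * k + 1) + f (2 * k + 1) * f (2 * k + 2)"
    by simp
  ultimately show ?case
    by (simp only: distrib_left distrib_right mult.commute[of "f (2 * k + 2)"])
qed

lemma sum_even_plus_odd:
  fixes f :: "nat \<Rightarrow> 'a::comm_monoid_add"
  shows "(\<Sum>i\<le>k. f (2 * i)) + (\<Sum>i<k. f (2 * i + 1)) = (\<Sum>i<2 * k + 1. f i)"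
  by (induction k) (simp_all add: ac_simps)

lemma odd_cycle_products_le:
  fixes h :: "nat \<Rightarrow> real"
  assumes "5 \<le> n" "odd n" and periodic: "\<And>i. h (i + n) = h i" and nonneg: "\<And>i. 0 \<le> h i"
  shows "(\<Sum>i<n. h i * h (i + 1)) \<le> (\<Sum>i<n. h i)\<^sup>2 / 4"
proof -
  obtain k where n: "n = 2 * k + 1"
    using \<open>odd n\<close> by (rule oddE)
  have k: "2 \<le> k"
    using \<open>5 \<le> n\<close> n by simp
  have "\<exists>j\<in>{..<n}. \<forall>i\<in>{..<n}. h j \<le> h i"
    using \<open>5 \<le> n\<close> by (intro bexI[of _ "arg_min_on h {..<n}"] ballI arg_min_least arg_min_if_finite) (auto simp: lessThan_empty_iff)
  then obtain j where j: "\<And>i. i < n \<Longrightarrow> h j \<le> h i"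
    by auto
  \<comment> \<open>Minimality of \<open>h j\<close> is extended beyond one period, since the index
    \<open>3 + (j + 1)\<close> compared with \<open>j\<close> below may exceed
    \<open>n\<close>.\<close>
  have "h i = h (i mod n)" for i
  proof (induction i rule: less_induct)
    case (less i)
    show ?case
      using less[of "i - n"] periodic[of "i - n"] \<open>5 \<le> n\<close>
      by (cases "i < n") (simp_all add: le_mod_geq)
  qed
  then have j: "h j \<le> h i" for i
    using j[of "i mod n"] \<open>5 \<le> n\<close> by simp
  define f where "f i = h (i + (j + 1))" for i
  have fnonneg: "0 \<le> f i" for i
    by (simp add: f_def nonneg)
  define X where "X = (\<Sum>i\<le>k. f (2 * i))"
  define Y where "Y = (\<Sum>i<k. f (2 * i + 1))"
  \<comment> \<open>The offset \<open>j + 1\<close> puts the minimum last: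
    \<open>2 * k + (j + 1) = j + n\<close>.\<close>
  have last: "f (2 * k) = h j"
    using periodic[of j] by (simp add: f_def n ac_simps)
  have wrap: "f (2 * k + 1) = f 0"
    using periodic[of "j + 1"] by (simp add: f_def n ac_simps)
  have "(\<Sum>i<n. h i * h (i + 1)) = (\<Sum>i<n. f i * f (i + 1))"
    using sum_shift_periodic[of "\<lambda>i. h i * h (i + 1)" n "j + 1"] periodic
    by (simp add: f_def) (metis add_Suc)
  also have "\<dots> = (\<Sum>i<2 * k. f i * f (i + 1)) + f 0 * f (2 * k)"
    using wrap by (simp add: n)
  also have "\<dots> \<le> (\<Sum>i<2 * k. f i * f (i + 1)) + f 0 * f 3"
    using j[of "3 + (j + 1)"] last by (intro add_left_mono mult_left_mono fnonneg) (simp add: f_def)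
  also have "\<dots> \<le> X * Y"
    unfolding X_def Y_def by (rule path_products_plus_chord_le[OF k fnonneg])
  also have "\<dots> \<le> (X + Y)\<^sup>2 / 4"
    using zero_le_power2[of "X - Y"] by (simp add: power2_sum power2_diff)
  also have "X + Y = (\<Sum>i<n. f i)"
    unfolding X_def Y_def n by (rule sum_even_plus_odd)
  also have "\<dots> = (\<Sum>i<n. h i)"
    unfolding f_def by (rule sum_shift_periodic) (rule periodic)
  finally show ?thesis .
qed

theorem theorem2:
  fixes n :: nat and V :: "'a set" and E :: "'a set set" and m :: "'a \<Rightarrow> real"
  assumes "5 \<le> n" and "odd n"
    and "cycle_graph n V E"
    and "load_distribution V m"
  shows "\<exists>m'. single_level_tree_distribution V E m' \<and>
              total_load V m' = total_load V m \<and>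
              flow E m' \<ge> flow E m"
proof -
  obtain c where c: "bij_betw c {..<n} V"
    and E: "E = {{c i, c ((i + 1) mod n)} | i. i < n}"
    using assms(3) unfolding cycle_graph_def by blast
  note graph = cycle_graph_finite_simple[OF assms(3)]
  have E_image: "E = (\<lambda>i. {c i, c ((i + 1) mod n)}) ` {..<n}"
    unfolding E by auto
  have cV: "c i \<in> V" if "i < n" for i
    using c that by (auto dest: bij_betwE)
  have nonneg: "0 \<le> m v" if "v \<in> V" for v
    using assms(4) that by (simp add: load_distribution_def)
  define D where "D = total_load V m"
  have D: "0 \<le> D"
    unfolding D_def total_load_def by (intro sum_nonneg nonneg)
  \<comment> \<open>Unrolling the cycle periodically turns the closing edge into an ordinary product
    \<open>h i * h (i + 1)\<close>.\<close>
  define h where "h i = m (c (i mod n))" for i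
  have edge_prod: "(\<Prod>v\<in>{c i, c ((i + 1) mod n)}. m v) = h i * h (i + 1)" if "i < n" for i
  proof -
    have "card {c i, c ((i + 1) mod n)} = 2"
      using graph(3) E that by blast
    then have "c i \<noteq> c ((i + 1) mod n)"
      by (auto simp: card_2_iff)
    then show ?thesis
      using that by (simp add: h_def)
  qed
  \<comment> \<open>An inequality suffices here, and it holds without checking that distinct indices
    give distinct edges: repeated nonnegative products could only enlarge the right side.\<close>
  have "flow E m \<le> (\<Sum>i<n. \<Prod>v\<in>{c i, c ((i + 1) mod n)}. m v)"
    unfolding flow_def E_image
    by (rule sum_image_le[unfolded comp_def]) (use assms(1) in \<open>auto intro!: prod_nonneg nonneg cV\<close>)
  also have "\<dots> = (\<Sum>i<n. h i * h (i + 1))"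
    by (intro sum.cong refl edge_prod) simp
  also have "\<dots> \<le> (\<Sum>i<n. h i)\<^sup>2 / 4"
    using assms(1) by (intro odd_cycle_products_le assms(1,2)) (simp_all add: h_def nonneg cV)
  also have "(\<Sum>i<n. h i) = D"
    using sum.reindex_bij_betw[OF c, of m] by (simp add: D_def total_load_def h_def)
  finally have upper: "flow E m \<le> D\<^sup>2 / 4" .
  define a where "a = c 0"
  define b where "b = c 1"
  have ab: "a \<in> V" "b \<in> V" "{a, b} \<in> E"
    using assms(1) cV unfolding a_def b_def E by (auto intro!: exI[of _ 0])
  have "card {a, b} = 2"
    using graph(3)[OF ab(3)] by simp
  then have neq: "a \<noteq> b"
    by (auto simp: card_2_iff)
  define m' where "m' v = (if v \<in> {a, b} then D / 2 else 0)" for v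
  have m'_nonneg: "0 \<le> m' v" for v
    using D by (simp add: m'_def)
  have "single_level_tree_distribution V E m'"
    unfolding single_level_tree_distribution_def load_distribution_def
    using ab m'_nonneg by (intro conjI ballI bexI[of _ a]) (auto simp: m'_def)
  moreover have "total_load V m' = D"
  proof -
    have "total_load V m' = sum m' {a, b}"
      unfolding total_load_def
      by (rule sum.mono_neutral_right) (use graph(1) ab in \<open>auto simp: m'_def\<close>)
    then show ?thesis
      using neq by (simp add: m'_def)
  qed
  moreover have "D\<^sup>2 / 4 \<le> flow E m'"
  proof -
    have "finite E"
      unfolding E_image by simp
    \<comment> \<open>The edge \<open>{a, b}\<close> alone reaches the bound; all other edges
      contribute nonnegative products.\<close>
    have "D\<^sup>2 / 4 = (\<Prod>v\<in>{a, b}. m' v)"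
      using neq by (simp add: m'_def power2_eq_square)
    also have "\<dots> \<le> flow E m'"
      unfolding flow_def
      by (rule member_le_sum) (use ab \<open>finite E\<close> m'_nonneg in \<open>auto intro: prod_nonneg\<close>)
    finally show ?thesis .
  qed
  ultimately show ?thesis
    using upper D_def by (intro exI[of _ m']) simp
qed

end
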